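(* Let $m$ and $n$ be even nonnegative integers and let $k$ be an integer with $0\le k\le\min(m,n)$. Then the central value $c_{m,n,k}\left(\frac m2,\frac n2\right)$ equals $0$ if and only if $k$ is odd.
   Context: For integers $m,n,k,i,j$ with $0\le k\le\min(m,n)$, $0\le i\le m$, $0\le j\le n$, $0\le i+j-k\le m+n-2k$, define $$c_{m,n,k}(i,j)=\sum_{l=0}^{k}(-1)^l\binom{i+j-k}{i-l}\binom{m-l}{k-l}\binom{n-k+l}{l},$$ where $\binom{a}{b}=0$ if $b<0$ or $b>a$. *)

theory Defs
  imports Main
begin

text \<open>Integer arguments, since the lower index \<open>i - l\<close> below can be negative.\<close>

definition binom :: "int \<Rightarrow> int \<Rightarrow> int" where
  "binom a b = (if b < 0 \<or> b > a then 0 else int (nat a choose nat b))"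

text \<open>Only meaningful for \<open>k \<le> min m n\<close>, \<open>i \<le> m\<close>, \<open>j \<le> n\<close>, \<open>k \<le> i + j\<close> and
  \<open>i + j - k \<le> m + n - 2 * k\<close>; all five parameters are then nonnegative, hence of type \<^typ>\<open>nat\<close>.\<close>

definition c :: "nat \<Rightarrow> nat \<Rightarrow> nat \<Rightarrow> nat \<Rightarrow> nat \<Rightarrow> int" where
  "c m n k i j =
    (\<Sum>l=0..k. (-1) ^ l * binom (int i + int j - int k) (int i - int l)
                       * binom (int m - int l) (int k - int l)
                       * binom (int n - int k + int l) (int l))"

end

theory Submission
  imports Defs "HOL-Computational_Algebra.Polynomial"
begin

text \<open>
  Let \<open>m = 2 a\<close> and \<open>n = 2 b\<close>. Up to a positive factor, \<open>c m n k a b\<close> is the coefficient of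
  \<open>x^a y^b\<close> in \<open>(1 + x)^(2a - k) (1 + y)^(2b - k) (x - y)^k\<close>. Expanding with
  \<open>2 (x - y) = (1 + x) (1 - y) - (1 - x) (1 + y)\<close> separates the variables: \<open>2^k\<close> times this
  coefficient is the alternating sum over \<open>j\<close> of \<open>k choose j\<close> times the central coefficients of
  \<open>(1 + x)^(2a - j) (1 - x)^j\<close> and \<open>(1 + y)^(2b - k + j) (1 - y)^(k - j)\<close>. Such a central
  coefficient vanishes for an odd power of \<open>1 - x\<close>, by reflection, and has the sign \<open>(-1)^p\<close> for the
  power \<open>2 p\<close>. For odd \<open>k\<close> every product is therefore zero; for even \<open>k\<close> all nonzero
  products have the same sign.
\<close>

section \<open>Central coefficients in one variable\<close>

text \<open>The value at \<open>s\<close> of the binary Krawtchouk polynomial of degree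
  \<open>n\<close> for length \<open>r + s\<close>, given by its generating function.\<close>

definition krawtchouk :: "nat \<Rightarrow> nat \<Rightarrow> nat \<Rightarrow> int" where
  "krawtchouk r s n = coeff ([:1, 1:] ^ r * [:1, -1:] ^ s) n"

lemma krawtchouk_0_right: "krawtchouk r 0 n = int (r choose n)"
  unfolding krawtchouk_def
  by (cases "n \<le> r") (simp_all add: coeff_linear_poly_power coeff_eq_0 degree_linear_power)

text \<open>Multiplying by \<open>1 + x\<close> or \<open>1 - x\<close> only adds or subtracts
  neighbouring coefficients, which commutes with \<open>of_int\<close>. The general ring is there
  for \<open>int poly\<close>, the coefficient ring once a second variable enters.\<close>

lemma coeff_krawtchouk:
  "coeff ([:1, 1:] ^ r * [:1, -1:] ^ s) n = (of_int (krawtchouk r s n) :: 'a :: comm_ring_1)"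
proof -
  have pos: "coeff ([:1, 1:] * p) n = coeff p n + (if n = 0 then 0 else coeff p (n - 1))"
    for p :: "'b :: comm_ring_1 poly" and n
    by (cases n) simp_all
  have neg: "coeff ([:1, -1:] * p) n = coeff p n - (if n = 0 then 0 else coeff p (n - 1))"
    for p :: "'b :: comm_ring_1 poly" and n
    by (cases n) simp_all
  have "coeff ([:1, -1:] ^ s) n = (of_int (coeff ([:1, -1:] ^ s) n) :: 'a)" for n
    by (induction s arbitrary: n) (simp_all only: power_Suc neg, simp_all)
  then show ?thesis
    unfolding krawtchouk_def
    by (induction r arbitrary: n) (simp_all only: power_Suc mult.assoc pos, simp_all)
qed

text \<open>Reversing the coefficients fixes \<open>1 + x\<close> and negates \<open>1 - x\<close>,
  so for odd \<open>s\<close> it negates the product. The middle coefficient stays in place and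
  hence equals its own negative.\<close>

lemma krawtchouk_odd:
  assumes "odd s" and "r + s = 2 * n"
  shows "krawtchouk r s n = 0"
proof -
  define p :: "int poly" where "p = [:1, 1:] ^ r * [:1, -1:] ^ s"
  have "degree p = r + s"
    unfolding p_def by (simp add: degree_mult_eq degree_power_eq)
  moreover have "reflect_poly p = - p"
  proof -
    have "[:-1, 1:] = - [:1, -1 :: int:]" by simp
    then have "[:-1, 1 :: int:] ^ s = - ([:1, -1:] ^ s)"
      using \<open>odd s\<close> by (metis power_minus_odd)
    then show ?thesis
      unfolding p_def
      by (simp add: reflect_poly_mult reflect_poly_power reflect_poly_pCons)
  qed
  ultimately have "coeff p n = - coeff p n"
    using assms(2) by (metis add_diff_cancel_right' coeff_minus coeff_reflect_poly
      le_add2 linorder_not_le mult_2)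
  then show ?thesis
    unfolding krawtchouk_def p_def by simp
qed

text \<open>The signless values are the super Catalan numbers \<open>(2p)! (2q)! / (p! q! (p + q)!)\<close>; the
  induction is on their recurrence \<open>4 S p q = S (p + 1) q + S p (q + 1)\<close>.\<close>

lemma krawtchouk_even:
  "krawtchouk (2 * q) (2 * p) (p + q) * (fact p * fact q * fact (p + q))
    = (-1) ^ p * fact (2 * p) * fact (2 * q)"
proof (induction p arbitrary: q)
  case 0
  have "fact q * fact q * (2 * q choose q) = (fact (2 * q) :: nat)"
    using binomial_fact_lemma[of q "2 * q"] by (simp add: mult_2)
  then have "int (fact q * fact q * (2 * q choose q)) = int (fact (2 * q))" by simp
  then show ?case
    by (simp add: krawtchouk_0_right algebra_simps)
next
  case (Suc p)
  \<comment> \<open>Source of the recurrence: \<open>(1 - x)^2 = (1 + x)^2 - 4 x\<close>, where the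
    factor \<open>x\<close> lowers the coefficient index by one.\<close>
  have sq: "[:1, -1 :: int:] ^ 2 = [:1, 1:] ^ 2 - 4 * [:0, 1:]"
    by (simp add: power2_eq_square numeral_poly)
  have "[:1, 1:] ^ (2 * q) * [:1, -1 :: int:] ^ (2 * Suc p) =
      [:1, 1:] ^ (2 * q) * [:1, -1:] ^ (2 * p) * [:1, -1 :: int:] ^ 2"
    by (simp only: power_add[symmetric] mult.assoc) (simp add: algebra_simps)
  also have "\<dots> = [:1, 1:] ^ (2 * Suc q) * [:1, -1:] ^ (2 * p)
      - [:0, 4:] * ([:1, 1:] ^ (2 * q) * [:1, -1:] ^ (2 * p))"
    unfolding sq by (simp add: algebra_simps power2_eq_square numeral_poly)
  finally have rec: "krawtchouk (2 * q) (2 * Suc p) (Suc p + q) =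
      krawtchouk (2 * Suc q) (2 * p) (p + Suc q) - 4 * krawtchouk (2 * q) (2 * p) (p + q)"
    unfolding krawtchouk_def by simp
  define X Y P R Z :: int
    where "X = krawtchouk (2 * Suc q) (2 * p) (p + Suc q)"
      and "Y = krawtchouk (2 * q) (2 * p) (p + q)"
      and "P = fact p * fact q * fact (p + q)"
      and "R = (-1) ^ p * fact (2 * p) * fact (2 * q)"
      and "Z = int p + int q + 1"
  \<comment> \<open>Passing to \<open>Suc q\<close> multiplies the denominator \<open>P\<close> by
    \<open>(q + 1) Z\<close> and the numerator by \<open>(2q + 1) (2q + 2)\<close>; the common
    \<open>q + 1\<close> is cancelled next.\<close>
  have "X * P * Z * (int q + 1) = R * (2 * (2 * int q + 1)) * (int q + 1)"
    using Suc.IH[of "Suc q"] unfolding X_def P_def R_def Z_def by (simp add: algebra_simps)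
  then have X: "X * P * Z = R * (2 * (2 * int q + 1))"
    by (simp only: mult_cancel_right) linarith
  have Y: "Y * P = R"
    using Suc.IH[of q] unfolding Y_def P_def R_def by simp
  have "(X - 4 * Y) * (P * Z * (int p + 1)) = (X * P * Z - 4 * (Y * P) * Z) * (int p + 1)"
    by (simp add: algebra_simps)
  \<comment> \<open>Here \<open>2 (2q + 1) - 4 (p + q + 1) = - 2 (2p + 1)\<close>, which produces
    the alternating sign.\<close>
  also have "\<dots> = - R * ((2 * int p + 1) * (2 * int p + 2))"
    unfolding X Y by (simp add: Z_def algebra_simps)
  finally have XY: "(X - 4 * Y) * (P * Z * (int p + 1)) = - R * ((2 * int p + 1) * (2 * int p + 2))" .
  have D: "fact (Suc p) * fact q * fact (Suc p + q) = P * Z * (int p + 1)"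
    unfolding P_def Z_def by (simp add: algebra_simps)
  have N: "(-1) ^ Suc p * fact (2 * Suc p) * fact (2 * q)
      = - R * ((2 * int p + 1) * (2 * int p + 2))"
    unfolding R_def by (simp add: algebra_simps)
  show ?case
    unfolding rec X_def[symmetric] Y_def[symmetric] D N by (rule XY)
qed

section \<open>Separation of the two variables\<close>

text \<open>The outer variable is \<open>y\<close>, the inner one \<open>x\<close>. Polynomials in
  \<open>x\<close> are constants for the outer \<open>coeff\<close>, and the
  \<open>y\<close>-coefficients are integers, so the extraction factorises.\<close>

lemma coeff_coeff_krawtchouk:
  "coeff (coeff ([:[:1, 1:]:] ^ r * [:[:1, -1:]:] ^ s * ([:1, 1:] ^ r' * [:1, -1:] ^ s')) b) a
    = krawtchouk r s a * krawtchouk r' s' b"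
proof -
  have C: "[:p:] ^ n = [:p ^ n:]" for p :: "int poly" and n
    by (induction n) (simp_all add: one_pCons)
  have D: "coeff (p * of_int z) a = coeff p a * z" for p :: "int poly" and z
    by (simp add: of_int_poly)
  show ?thesis
    by (simp add: C coeff_krawtchouk D) (simp add: krawtchouk_def mult.commute)
qed

text \<open>Both sides are the coefficient of \<open>x^a y^b\<close> in
  \<open>2^k (1 + x)^r (1 + y)^s (x - y)^k\<close>, expanded before and after rewriting
  \<open>2 (x - y)\<close>. It is applied with \<open>r = 2a - k\<close> and
  \<open>s = 2b - k\<close>.\<close>

lemma binomial_sum_eq_krawtchouk_sum:
  "2 ^ k * (\<Sum>l\<le>k. (-1) ^ l * int (k choose l) * int ((r + (k - l)) choose a) * int ((s + l) choose b))
    = (\<Sum>j\<le>k. (-1) ^ j * int (k choose j)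
        * krawtchouk (r + (k - j)) j a * krawtchouk (s + j) (k - j) b)"
proof -
  define u u' v v' :: "int poly poly"
    where "u = [:[:1, 1:]:]" and "u' = [:[:1, -1:]:]" and "v = [:1, 1:]" and "v' = [:1, -1:]"
  define E where "E P = coeff (coeff P b) a" for P :: "int poly poly"
  have E_sum: "E (\<Sum>j\<in>A. f j) = (\<Sum>j\<in>A. E (f j))" for f and A :: "nat set"
    unfolding E_def by (simp add: coeff_sum)
  have E_mult: "E (of_int z * P) = z * E P" for z P
    unfolding E_def by (simp add: of_int_poly)
  have E_prod: "E (u ^ i * u' ^ j * (v ^ i' * v' ^ j')) = krawtchouk i j a * krawtchouk i' j' b"
    for i j i' j'
    unfolding E_def u_def u'_def v_def v'_def by (rule coeff_coeff_krawtchouk)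
  have "u * v' - u' * v = 2 * (u - v)"
    unfolding u_def u'_def v_def v'_def by (simp add: numeral_poly one_pCons)
  \<comment> \<open>The negated summand comes first so that \<open>binomial_ring\<close> gives it
    the summation index as exponent, hence the sign \<open>(-1)^j\<close>.\<close>
  then have base: "- (u' * v) + u * v' = 2 * (- v + u)" by simp
  have eq: "2 ^ k * (u ^ r * v ^ s * (- v + u) ^ k) = u ^ r * v ^ s * (- (u' * v) + u * v') ^ k"
    unfolding base power_mult_distrib by (simp only: mult_ac)
  \<comment> \<open>The trivial powers \<open>u' ^ 0\<close> and \<open>v' ^ 0\<close> let
    \<open>E_prod\<close> serve both expansions.\<close>
  have "u ^ r * v ^ s * (- v + u) ^ k
      = (\<Sum>l\<le>k. of_int ((-1) ^ l * int (k choose l))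
          * (u ^ (r + (k - l)) * u' ^ 0 * (v ^ (s + l) * v' ^ 0)))"
    unfolding binomial_ring sum_distrib_left
    by (intro sum.cong refl)
      (simp only: power_add power_minus[of v] power_0 mult_1_right mult_ac
        of_int_mult of_int_power of_int_minus of_int_1 of_int_of_nat_eq)
  then have lhs: "E (u ^ r * v ^ s * (- v + u) ^ k)
      = (\<Sum>l\<le>k. (-1) ^ l * int (k choose l) * int ((r + (k - l)) choose a) * int ((s + l) choose b))"
    by (simp only: E_sum E_mult E_prod krawtchouk_0_right) (simp only: mult.assoc)
  have "u ^ r * v ^ s * (- (u' * v) + u * v') ^ k
      = (\<Sum>j\<le>k. of_int ((-1) ^ j * int (k choose j))
          * (u ^ (r + (k - j)) * u' ^ j * (v ^ (s + j) * v' ^ (k - j))))"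
    unfolding binomial_ring sum_distrib_left
    by (intro sum.cong refl)
      (simp only: power_add power_minus[of "u' * v"] power_mult_distrib mult_ac
        of_int_mult of_int_power of_int_minus of_int_1 of_int_of_nat_eq)
  then have rhs: "E (u ^ r * v ^ s * (- (u' * v) + u * v') ^ k)
      = (\<Sum>j\<le>k. (-1) ^ j * int (k choose j)
          * krawtchouk (r + (k - j)) j a * krawtchouk (s + j) (k - j) b)"
    by (simp only: E_sum E_mult E_prod) (simp only: mult.assoc)
  show ?thesis
    using arg_cong[OF eq, of E] E_mult[of "2 ^ k"] lhs rhs by simp
qed

section \<open>Signs in the separated sum\<close>

lemma krawtchouk_sum_eq_0_iff:
  assumes "k \<le> 2 * a" and "k \<le> 2 * b"
  shows "(\<Sum>j\<le>k. (-1) ^ j * int (k choose j)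
        * krawtchouk (2 * a - j) j a * krawtchouk (2 * b - (k - j)) (k - j) b) = 0 \<longleftrightarrow> odd k"
    (is "(\<Sum>j\<le>k. ?t j) = 0 \<longleftrightarrow> _")
proof
  assume "odd k"
  have "?t j = 0" if "j \<le> k" for j
  proof (cases "odd j")
    case True
    then show ?thesis using that assms by (simp add: krawtchouk_odd)
  next
    case False
    then have "odd (k - j)" using \<open>odd k\<close> that by simp
    then show ?thesis using that assms by (simp add: krawtchouk_odd)
  qed
  then show "(\<Sum>j\<le>k. ?t j) = 0" by (intro sum.neutral) simp
next
  assume sum0: "(\<Sum>j\<le>k. ?t j) = 0"
  show "odd k"
  proof
    assume "even k"
    have sign: "(-1) ^ (j div 2) * krawtchouk (2 * d - j) j d > 0"
      if "even j" "j \<le> 2 * d" for j d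
    proof -
      obtain p where j: "j = 2 * p" using \<open>even j\<close> by blast
      define q where "q = d - p"
      have d: "d = p + q" using that j q_def by simp
      define F :: int where "F = fact p * fact q * fact (p + q)"
      have "F > 0" unfolding F_def by simp
      have "(-1) ^ p * krawtchouk (2 * q) (2 * p) (p + q) * F = fact (2 * p) * fact (2 * q)"
        unfolding F_def mult.assoc krawtchouk_even[unfolded mult.assoc]
        by (simp add: power_add[symmetric] flip: mult.assoc)
      then have "(-1) ^ p * krawtchouk (2 * q) (2 * p) (p + q) * F > 0" by simp
      then have "(-1) ^ p * krawtchouk (2 * q) (2 * p) (p + q) > 0"
        using \<open>F > 0\<close> by (simp add: zero_less_mult_iff)
      then show ?thesis unfolding j d by simp
    qed
    \<comment> \<open>The factors contribute the signs \<open>(-1)^(j/2)\<close> and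
      \<open>(-1)^((k - j)/2)\<close>, whose product does not depend on \<open>j\<close>.\<close>
    have pos: "(-1) ^ (k div 2) * ?t j > 0" if "j \<le> k" "even j" for j
    proof -
      have "even (k - j)" using \<open>even k\<close> that by simp
      have "k div 2 = j div 2 + (k - j) div 2"
        using \<open>even (k - j)\<close> \<open>even j\<close> \<open>j \<le> k\<close>
        by (metis div_plus_div_distrib_dvd_left le_add_diff_inverse)
      then have "(-1 :: int) ^ (k div 2) = (-1) ^ (j div 2) * (-1) ^ ((k - j) div 2)"
        by (metis power_add)
      then have "(-1) ^ (k div 2) * ?t j = int (k choose j)
          * ((-1) ^ (j div 2) * krawtchouk (2 * a - j) j a)
          * ((-1) ^ ((k - j) div 2) * krawtchouk (2 * b - (k - j)) (k - j) b)"
        using \<open>even j\<close> by (simp only: neg_one_even_power mult_1 mult_ac)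
      also have "\<dots> > 0"
      proof (rule mult_pos_pos[OF mult_pos_pos])
        show "0 < int (k choose j)" using \<open>j \<le> k\<close> by simp
        show "0 < (-1) ^ (j div 2) * krawtchouk (2 * a - j) j a"
          using that assms by (intro sign) simp_all
        show "0 < (-1) ^ ((k - j) div 2) * krawtchouk (2 * b - (k - j)) (k - j) b"
          using \<open>even (k - j)\<close> assms by (intro sign) simp_all
      qed
      finally show ?thesis .
    qed
    have nonneg: "(-1) ^ (k div 2) * ?t j \<ge> 0" if "j \<le> k" for j
    proof (cases "even j")
      case True
      then show ?thesis using pos[OF that] by simp
    next
      case False
      then show ?thesis using that assms by (simp add: krawtchouk_odd)
    qed
    \<comment> \<open>The index \<open>j = 0\<close> is even, so at least one term is strictly
      positive.\<close>
    have "0 < (\<Sum>j\<le>k. (-1) ^ (k div 2) * ?t j)"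
      using nonneg pos[of 0] by (intro sum_pos2[of _ 0]) simp_all
    then show False
      using sum0 by (simp flip: sum_distrib_left)
  qed
qed

section \<open>From \<open>c\<close> to the coefficient sum\<close>

text \<open>Termwise, both sides regroup the same factorials; the factors taken out do not depend on
  \<open>l\<close>.\<close>

lemma c_central:
  assumes "k \<le> 2 * a" and "k \<le> 2 * b"
  shows "c (2 * a) (2 * b) k a b * (fact k * fact (2 * a - k) * fact (2 * b - k))
    = fact (a + b - k) * fact a * fact b *
      (\<Sum>l\<le>k. (-1) ^ l * int (k choose l) * int ((2 * a - l) choose a) * int ((2 * b - (k - l)) choose b))"
proof -
  have binom: "binom (int x) (int y) = int (x choose y)" for x y
    by (simp add: binom_def)
  have key: "binom (int a + int b - int k) (int a - int l)
      * binom (int (2 * a) - int l) (int k - int l) * binom (int (2 * b) - int k + int l) (int l)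
      * (fact k * fact (2 * a - k) * fact (2 * b - k))
    = fact (a + b - k) * fact a * fact b
      * (int (k choose l) * int ((2 * a - l) choose a) * int ((2 * b - (k - l)) choose b))"
    if "l \<le> k" for l
  \<comment> \<open>Outside this range both sides vanish: \<open>a - l\<close> is negative or
    exceeds \<open>a + b - k\<close>, and one of the two right-hand binomials has too small an upper
    index.\<close>
  proof (cases "l \<le> a \<and> k - l \<le> b")
    case False
    then have "binom (int a + int b - int k) (int a - int l) = 0"
      unfolding binom_def using that by auto
    moreover have "2 * a - l < a \<or> 2 * b - (k - l) < b"
      using False that assms by auto
    ultimately show ?thesis by (auto simp: binomial_eq_0)
  next
    case True
    have args: "int a + int b - int k = int (a + b - k)" "int a - int l = int (a - l)"
      "int (2 * a) - int l = int (2 * a - l)" "int k - int l = int (k - l)"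
      "int (2 * b) - int k + int l = int (2 * b - (k - l))"
      using that assms True by auto
    \<comment> \<open>Over the reals binomials are quotients of factorials and the identity is mere
      cancellation; injectivity of \<open>real_of_int\<close> brings it back to the
      integers.\<close>
    have fac: "real (x choose y) = fact x / (fact y * fact z)" if "x = y + z" for x y z
      using binomial_fact[of y x, where 'a = real] that by simp
    have "real ((a + b - k) choose (a - l)) = fact (a + b - k) / (fact (a - l) * fact (b - (k - l)))"
      "real ((2 * a - l) choose (k - l)) = fact (2 * a - l) / (fact (k - l) * fact (2 * a - k))"
      "real ((2 * b - (k - l)) choose l) = fact (2 * b - (k - l)) / (fact l * fact (2 * b - k))"
      "real (k choose l) = fact k / (fact l * fact (k - l))"
      "real ((2 * a - l) choose a) = fact (2 * a - l) / (fact a * fact (a - l))"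
      "real ((2 * b - (k - l)) choose b) = fact (2 * b - (k - l)) / (fact b * fact (b - (k - l)))"
      using that assms True by (auto intro!: fac)
    then have "real ((a + b - k) choose (a - l)) * real ((2 * a - l) choose (k - l))
        * real ((2 * b - (k - l)) choose l) * (fact k * fact (2 * a - k) * fact (2 * b - k))
      = fact (a + b - k) * fact a * fact b
        * (real (k choose l) * real ((2 * a - l) choose a) * real ((2 * b - (k - l)) choose b))"
      by (simp add: mult_ac)
    then have "real_of_int (int ((a + b - k) choose (a - l)) * int ((2 * a - l) choose (k - l))
        * int ((2 * b - (k - l)) choose l) * (fact k * fact (2 * a - k) * fact (2 * b - k)))
      = real_of_int (fact (a + b - k) * fact a * fact b
        * (int (k choose l) * int ((2 * a - l) choose a) * int ((2 * b - (k - l)) choose b)))"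
      by simp
    then show ?thesis
      unfolding args binom of_int_eq_iff .
  qed
  show ?thesis
    unfolding c_def atLeast0AtMost sum_distrib_left sum_distrib_right
  proof (intro sum.cong refl, goal_cases)
    case (1 l)
    then show ?case
      using arg_cong[OF key[of l], of "\<lambda>t. (-1) ^ l * t"] by (simp add: mult_ac)
  qed
qed

theorem proposition15:
  fixes m n k :: nat
  assumes "even m" and "even n" and "k \<le> min m n"
  shows "c m n k (m div 2) (n div 2) = 0 \<longleftrightarrow> odd k"
proof -
  obtain a b where m: "m = 2 * a" and n: "n = 2 * b"
    using assms(1,2) by blast
  have k: "k \<le> 2 * a" "k \<le> 2 * b"
    using assms(3) m n by simp_all
  \<comment> \<open>The coefficient of \<open>x^a y^b\<close> in
    \<open>(1 + x)^(2a - k) (1 + y)^(2b - k) (x - y)^k\<close>.\<close>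
  define T where "T = (\<Sum>l\<le>k. (-1) ^ l * int (k choose l)
    * int ((2 * a - l) choose a) * int ((2 * b - (k - l)) choose b))"
  have "2 ^ k * T = (\<Sum>j\<le>k. (-1) ^ j * int (k choose j)
      * krawtchouk (2 * a - j) j a * krawtchouk (2 * b - (k - j)) (k - j) b)"
    using binomial_sum_eq_krawtchouk_sum[of k "2 * a - k" a "2 * b - k" b] k
    unfolding T_def by simp
  then have "T = 0 \<longleftrightarrow> odd k"
    using krawtchouk_sum_eq_0_iff[OF k] by (metis mult_eq_0_iff power_not_zero zero_neq_numeral)
  moreover have "c m n k (m div 2) (n div 2) = 0 \<longleftrightarrow> T = 0"
  proof -
    have "c m n k (m div 2) (n div 2) * (fact k * fact (2 * a - k) * fact (2 * b - k))
        = fact (a + b - k) * fact a * fact b * T"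
      using c_central[OF k] unfolding m n T_def by simp
    then show ?thesis by (metis fact_nonzero mult_eq_0_iff)
  qed
  ultimately show ?thesis by simp
qed

end
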